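(* Let $G\cong(B,W)$ be a weighted graph with vertex set $V$, $|V|=n$, and let $P\in\mathbb{R}^{k\times n}$ be an $\alpha$-approximate linear cost approximator for $G$. Define, for each proper demand $d$, $\phi(d):=P^T\,\mathrm{sign}(Pd)$, where $\mathrm{sign}$ is applied coordinatewise. Then the map $d\mapsto\phi(d)$ is an $\alpha$-approximate dual-only preconditioner for $G$.
   Context: Let $G=(V,E)$ be an undirected graph with $V=\{v_1,\dots,v_n\}$, edges oriented as $\vec E=\{(v_i,v_j):\{v_i,v_j\}\in E,\ i<j\}$, incidence matrix $B\in\{-1,0,1\}^{V\times\vec E}$ (for $e=(s,t)$: $B_{s,e}=1$, $B_{t,e}=-1$, other entries $0$), and $W$ the diagonal matrix of edge weights $w(e)\ge1$. A demand $d\in\mathbb{R}^V$ is proper if $\sum_vd_v=0$; a flow $f\in\mathbb{R}^{\vec E}$ routes $d$ if $Bf=d$ and has cost $\|Wf\|_1$; $\|d\|_{\mathrm{OPT}}$ is the minimum cost of a flow routing $d$. An $\alpha$-approximate linear cost approximator for $G$ is a matrix $P\in\mathbb{R}^{k\times n}$ such that $\|d\|_{\mathrm{OPT}}\le\|Pd\|_1\le\alpha\|d\|_{\mathrm{OPT}}$ for every proper demand $d$. An $\alpha$-approximate dual-only preconditioner for $G$ is a function mapping every proper demand $d$ to potentials $\phi\in\mathbb{R}^V$ such that $\|W^{-1}B^T\phi\|_\infty\le\alpha$ and there exists a flow $f$ with $Bf=d$ and $\|Wf\|_1\le\langle d,\phi\rangle$. *)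

theory Defs
  imports "Jordan_Normal_Form.Matrix" "HOL-Library.Extended_Real"
begin

text \<open>
  A weighted graph is given by a number \<open>n\<close>, a set \<open>E\<close> of two-element subsets of
  \<open>V = {0..<n}\<close> and a weight function \<open>w\<close> on \<open>E\<close>.  The vertex \<open>i\<close> stands for
  \<open>v\<close> with index \<open>i + 1\<close>.  The graph need not be connected.
\<close>

definition weighted_graph :: "nat \<Rightarrow> nat set set \<Rightarrow> (nat set \<Rightarrow> real) \<Rightarrow> bool" where
  "weighted_graph n E w \<longleftrightarrow>
     (\<forall>e\<in>E. \<exists>i j. i < n \<and> j < n \<and> i \<noteq> j \<and> e = {i, j}) \<and> (\<forall>e\<in>E. 1 \<le> w e)"

definition oriented_edges :: "nat set set \<Rightarrow> (nat \<times> nat) set" where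
  "oriented_edges E = {(i, j). {i, j} \<in> E \<and> i < j}"

text \<open>
  The coordinates of a flow, and the columns of the incidence matrix, are the oriented
  edges in lexicographic order; \<open>edge_list\<close> fixes this enumeration.
\<close>

definition edge_list :: "nat \<Rightarrow> nat set set \<Rightarrow> (nat \<times> nat) list" where
  "edge_list n E =
     filter (\<lambda>e. e \<in> oriented_edges E) (List.product [0..<n] [0..<n])"

lemma distinct_edge_list: "distinct (edge_list n E)"
  by (simp add: edge_list_def distinct_product)

lemma set_edge_list:
  assumes "weighted_graph n E w"
  shows "set (edge_list n E) = oriented_edges E"
proof -
  have "i < n \<and> j < n" if "{i, j} \<in> E" for i j
    using assms that unfolding weighted_graph_def by (metis doubleton_eq_iff)
  then show ?thesis
    by (auto simp: edge_list_def oriented_edges_def)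
qed

definition num_edges :: "nat \<Rightarrow> nat set set \<Rightarrow> nat" where
  "num_edges n E = length (edge_list n E)"

definition incidence_mat :: "nat \<Rightarrow> nat set set \<Rightarrow> real mat" where
  "incidence_mat n E = mat n (num_edges n E)
     (\<lambda>(v, l). let (s, t) = edge_list n E ! l in
        if v = s then 1 else if v = t then - 1 else 0)"

definition edge_weight :: "nat \<Rightarrow> nat set set \<Rightarrow> (nat set \<Rightarrow> real) \<Rightarrow> nat \<Rightarrow> real" where
  "edge_weight n E w l = (let (s, t) = edge_list n E ! l in w {s, t})"

definition weight_mat :: "nat \<Rightarrow> nat set set \<Rightarrow> (nat set \<Rightarrow> real) \<Rightarrow> real mat" where
  "weight_mat n E w = mat_diag (num_edges n E) (edge_weight n E w)"

definition weight_mat_inv :: "nat \<Rightarrow> nat set set \<Rightarrow> (nat set \<Rightarrow> real) \<Rightarrow> real mat" where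
  "weight_mat_inv n E w = mat_diag (num_edges n E) (\<lambda>l. 1 / edge_weight n E w l)"

lemma weight_mat_inv:
  assumes "weighted_graph n E w"
  shows "inverts_mat (weight_mat n E w) (weight_mat_inv n E w)"
    and "inverts_mat (weight_mat_inv n E w) (weight_mat n E w)"
proof -
  have "edge_weight n E w l \<noteq> 0" if "l < num_edges n E" for l
  proof -
    obtain s t where st: "edge_list n E ! l = (s, t)"
      by fastforce
    have "(s, t) \<in> oriented_edges E"
      using that st set_edge_list[OF assms] nth_mem[of l "edge_list n E"]
      by (simp add: num_edges_def)
    then have "1 \<le> w {s, t}"
      using assms by (simp add: oriented_edges_def weighted_graph_def)
    then show ?thesis
      by (simp add: edge_weight_def st)
  qed
  then show "inverts_mat (weight_mat n E w) (weight_mat_inv n E w)"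
    and "inverts_mat (weight_mat_inv n E w) (weight_mat n E w)"
    unfolding inverts_mat_def weight_mat_def weight_mat_inv_def mat_diag_diag
    by (auto intro!: eq_matI simp: mat_diag_def)
qed

definition l1_norm :: "real vec \<Rightarrow> real" where
  "l1_norm x = (\<Sum>i<dim_vec x. \<bar>x $ i\<bar>)"

text \<open>The element \<open>0\<close> only matters for vectors of dimension 0.\<close>

definition linf_norm :: "real vec \<Rightarrow> real" where
  "linf_norm x = Max (insert 0 ((\<lambda>i. \<bar>x $ i\<bar>) ` {..<dim_vec x}))"

definition sign_vec :: "real vec \<Rightarrow> real vec" where
  "sign_vec x = map_vec sgn x"

definition proper_demand :: "nat \<Rightarrow> real vec \<Rightarrow> bool" where
  "proper_demand n d \<longleftrightarrow> d \<in> carrier_vec n \<and> (\<Sum>v<n. d $ v) = 0"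

definition routes :: "nat \<Rightarrow> nat set set \<Rightarrow> real vec \<Rightarrow> real vec \<Rightarrow> bool" where
  "routes n E f d \<longleftrightarrow> f \<in> carrier_vec (num_edges n E) \<and> incidence_mat n E *\<^sub>v f = d"

definition flow_cost :: "nat \<Rightarrow> nat set set \<Rightarrow> (nat set \<Rightarrow> real) \<Rightarrow> real vec \<Rightarrow> real" where
  "flow_cost n E w f = l1_norm (weight_mat n E w *\<^sub>v f)"

text \<open>
  The optimal cost is extended-real valued: it is \<open>\<infinity>\<close> for a demand that no flow routes.
  For a routable demand the infimum is attained.
\<close>

definition opt_cost :: "nat \<Rightarrow> nat set set \<Rightarrow> (nat set \<Rightarrow> real) \<Rightarrow> real vec \<Rightarrow> ereal" where
  "opt_cost n E w d = (INF f\<in>{f. routes n E f d}. ereal (flow_cost n E w f))"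

definition linear_cost_approximator ::
  "real \<Rightarrow> nat \<Rightarrow> nat set set \<Rightarrow> (nat set \<Rightarrow> real) \<Rightarrow> nat \<Rightarrow> real mat \<Rightarrow> bool" where
  "linear_cost_approximator \<alpha> n E w k P \<longleftrightarrow>
     P \<in> carrier_mat k n \<and>
     (\<forall>d. proper_demand n d \<longrightarrow>
        opt_cost n E w d \<le> ereal (l1_norm (P *\<^sub>v d)) \<and>
        ereal (l1_norm (P *\<^sub>v d)) \<le> ereal \<alpha> * opt_cost n E w d)"

definition dual_only_preconditioner ::
  "real \<Rightarrow> nat \<Rightarrow> nat set set \<Rightarrow> (nat set \<Rightarrow> real) \<Rightarrow> (real vec \<Rightarrow> real vec) \<Rightarrow> bool" where
  "dual_only_preconditioner \<alpha> n E w \<phi> \<longleftrightarrow>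
     (\<forall>d. proper_demand n d \<longrightarrow>
        \<phi> d \<in> carrier_vec n \<and>
        linf_norm (weight_mat_inv n E w *\<^sub>v (transpose_mat (incidence_mat n E) *\<^sub>v \<phi> d)) \<le> \<alpha> \<and>
        (\<exists>f. routes n E f d \<and> flow_cost n E w f \<le> d \<bullet> \<phi> d))"

end

(* For the primal condition, \<langle>d, \<phi>(d)\<rangle> = \<langle>Pd, sign(Pd)\<rangle> = \<parallel>Pd\<parallel>\<^sub>1 is at least the optimal cost of d, and the
   optimum is attained because the weights are at least 1, so that flows of bounded cost form a
   compact set.  For the dual condition, the entry of B\<^sup>T \<phi>(d) at an edge e with incidence column b
   is \<langle>sign(Pd), Pb\<rangle>, which is at most \<parallel>Pb\<parallel>\<^sub>1 \<le> \<alpha> w(e), since the unit flow on e routes b. *)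
theory Submission
  imports Defs "HOL-Analysis.Function_Topology"
begin

text \<open>Tychonoff: the box is a product of compact intervals. Working with functions in the
  product topology lets the number of coordinates be a variable instead of being fixed by a
  type.\<close>

lemma compact_coordinate_box:
  fixes a b :: "'a \<Rightarrow> real"
  shows "compact {x. \<forall>i. x i \<in> {a i..b i}}"
proof -
  have "{x. \<forall>i. x i \<in> {a i..b i}} = PiE UNIV (\<lambda>i. {a i..b i})"
    by (auto simp: PiE_def Pi_def)
  moreover have "compactin (product_topology (\<lambda>_. euclidean) UNIV) (PiE UNIV (\<lambda>i. {a i..b i}))"
    by (auto simp: compactin_PiE)
  ultimately show ?thesis
    by (metis compactin_euclidean_iff euclidean_product_topology)
qed

text \<open>Since every \<open>c l\<close> is at least 1, the cost dominates each of the first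
  \<open>m\<close> coordinates. Competitors no worse than \<open>f0\<close> therefore lie in a box,
  and a continuous cost attains its minimum on the compact feasible part of that box.\<close>

lemma linear_system_weighted_l1_minimizer:
  fixes A :: "nat \<Rightarrow> nat \<Rightarrow> real" and c :: "nat \<Rightarrow> real"
  assumes c: "\<And>l. l < m \<Longrightarrow> 1 \<le> c l"
    and feasible: "\<forall>v<n. (\<Sum>l<m. A v l * f0 l) = d v"
  obtains f where "\<forall>v<n. (\<Sum>l<m. A v l * f l) = d v"
    and "\<And>g. \<forall>v<n. (\<Sum>l<m. A v l * g l) = d v \<Longrightarrow>
      (\<Sum>l<m. c l * \<bar>f l\<bar>) \<le> (\<Sum>l<m. c l * \<bar>g l\<bar>)"
proof -
  define cost where "cost g = (\<Sum>l<m. c l * \<bar>g l\<bar>)" for g :: "nat \<Rightarrow> real"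
  \<comment> \<open>A function on \<open>nat\<close> has coordinates beyond \<open>m\<close> that
    neither the cost nor the constraints see. Setting them to 0 changes nothing and makes
    boundedness possible.\<close>
  define restr where "restr g l = (if l < m then g l else 0)" for g :: "nat \<Rightarrow> real" and l
  define C where "C = cost f0"
  define F where "F = {g :: nat \<Rightarrow> real. \<forall>v<n. (\<Sum>l<m. A v l * g l) = d v}"
  \<comment> \<open>For \<open>l \<ge> m\<close> the interval degenerates to the single point 0,
    matching \<open>restr\<close>.\<close>
  define K where "K = {g :: nat \<Rightarrow> real. \<forall>l. g l \<in> {(if l < m then - C else 0)..(if l < m then C else 0)}}"
  have cost_restr: "cost (restr g) = cost g" for g
    by (simp add: cost_def restr_def)
  have restr_F: "restr g \<in> F \<longleftrightarrow> g \<in> F" for g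
    by (simp add: F_def restr_def)
  have bound: "\<bar>g l\<bar> \<le> cost g" if "l < m" for g l
  proof -
    have "\<bar>g l\<bar> \<le> c l * \<bar>g l\<bar>"
      using c[OF that] mult_right_mono[of 1 "c l" "\<bar>g l\<bar>"] by simp
    also have "\<dots> \<le> cost g"
      unfolding cost_def using that
      by (intro member_le_sum) (auto intro!: mult_nonneg_nonneg dest: c)
    finally show ?thesis .
  qed
  have in_K: "restr g \<in> K" if "cost g \<le> C" for g
    using that bound[of _ g] by (fastforce simp: K_def restr_def abs_le_iff)
  \<comment> \<open>Feasibility is an intersection of solution sets of linear equations, each closed
    because it involves only finitely many continuous coordinates.\<close>
  have "F = (\<Inter>v\<in>{..<n}. {g. (\<Sum>l<m. A v l * g l) = d v})"
    by (auto simp: F_def)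
  moreover have "closed {g :: nat \<Rightarrow> real. (\<Sum>l<m. A v l * g l) = d v}" for v
    by (intro closed_Collect_eq continuous_intros continuous_on_product_coordinates)
  ultimately have "closed F"
    by auto
  then have "compact (K \<inter> F)"
    unfolding K_def using compact_coordinate_box by (rule compact_Int_closed[rotated])
  moreover have f0: "restr f0 \<in> K \<inter> F"
    using in_K[of f0] feasible restr_F by (simp add: C_def F_def)
  moreover have "continuous_on (K \<inter> F) cost"
    unfolding cost_def
    by (intro continuous_intros continuous_on_subset[OF continuous_on_product_coordinates]) auto
  ultimately obtain f where f: "f \<in> K \<inter> F" and min: "\<And>g. g \<in> K \<inter> F \<Longrightarrow> cost f \<le> cost g"
    using continuous_attains_inf[of "K \<inter> F" cost] by blast
  have "cost f \<le> cost g" if "g \<in> F" for g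
  proof (cases "cost g \<le> C")
    case True
    then show ?thesis
      using min[of "restr g"] in_K that restr_F cost_restr by auto
  next
    \<comment> \<open>Outside the box the minimizer still wins:
      \<open>cost f \<le> cost (restr f0) = C < cost g\<close>.\<close>
    case False
    then show ?thesis
      using min[OF f0] cost_restr by (simp add: C_def)
  qed
  then show thesis
    using f that unfolding F_def cost_def by auto
qed

lemma incidence_mat_carrier [simp]: "incidence_mat n E \<in> carrier_mat n (num_edges n E)"
  by (simp add: incidence_mat_def)

lemma mat_diag_mult_vec:
  fixes x :: "'a :: comm_semiring_1 vec"
  assumes "x \<in> carrier_vec m"
  shows "mat_diag m c *\<^sub>v x = vec m (\<lambda>l. c l * x $ l)"
proof (rule eq_vecI)
  fix l assume "l < dim_vec (vec m (\<lambda>l. c l * x $ l))"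
  then show "(mat_diag m c *\<^sub>v x) $ l = vec m (\<lambda>l. c l * x $ l) $ l"
    using assms by (simp add: mat_diag_def scalar_prod_def sum.remove[of _ l])
qed (simp add: mat_diag_def)

lemma edge_list_nth:
  assumes "weighted_graph n E w" and "l < num_edges n E"
  obtains s t where "edge_list n E ! l = (s, t)" "s < t" "t < n" "1 \<le> w {s, t}"
proof -
  obtain s t where st: "edge_list n E ! l = (s, t)"
    by fastforce
  have mem: "(s, t) \<in> set (edge_list n E)"
    using assms(2) st nth_mem[of l "edge_list n E"] by (simp add: num_edges_def)
  then have "s < t" "t < n" "{s, t} \<in> E"
    by (auto simp: edge_list_def oriented_edges_def)
  moreover from this have "1 \<le> w {s, t}"
    using assms(1) by (simp add: weighted_graph_def)
  ultimately show thesis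
    using that st by blast
qed

lemma edge_weight_ge_1:
  assumes "weighted_graph n E w" and "l < num_edges n E"
  shows "1 \<le> edge_weight n E w l"
proof -
  obtain s t where "edge_list n E ! l = (s, t)" "1 \<le> w {s, t}"
    using edge_list_nth[OF assms] by blast
  then show ?thesis
    by (simp add: edge_weight_def)
qed

lemma flow_cost_eq_sum:
  assumes "weighted_graph n E w" and "f \<in> carrier_vec (num_edges n E)"
  shows "flow_cost n E w f = (\<Sum>l<num_edges n E. edge_weight n E w l * \<bar>f $ l\<bar>)"
proof -
  \<comment> \<open>Positivity of the weights lets them leave the absolute value.\<close>
  have "\<bar>edge_weight n E w l * f $ l\<bar> = edge_weight n E w l * \<bar>f $ l\<bar>" if "l < num_edges n E" for l
    using edge_weight_ge_1[OF assms(1) that] by (simp add: abs_mult)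
  then show ?thesis
    by (simp add: flow_cost_def weight_mat_def mat_diag_mult_vec[OF assms(2)] l1_norm_def)
qed

text \<open>Translates between vectors and the coordinate functions of
  \<open>linear_system_weighted_l1_minimizer\<close>.\<close>

lemma routes_iff_sum:
  assumes "d \<in> carrier_vec n"
  shows "routes n E f d \<longleftrightarrow> f \<in> carrier_vec (num_edges n E) \<and>
    (\<forall>v<n. (\<Sum>l<num_edges n E. incidence_mat n E $$ (v, l) * f $ l) = d $ v)"
proof -
  let ?B = "incidence_mat n E" and ?m = "num_edges n E"
  have "(?B *\<^sub>v f) $ v = (\<Sum>l<?m. ?B $$ (v, l) * f $ l)"
    if "f \<in> carrier_vec ?m" and "v < n" for v
    using that carrier_matD[OF incidence_mat_carrier, of n E]
    by (simp add: scalar_prod_def lessThan_atLeast0)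
  moreover have "?B *\<^sub>v f = d \<longleftrightarrow> (\<forall>v<n. (?B *\<^sub>v f) $ v = d $ v)"
    using carrier_vecD[OF assms] carrier_matD(1)[OF incidence_mat_carrier, of n E]
    by (simp add: vec_eq_iff)
  ultimately show ?thesis
    by (auto simp: routes_def)
qed

lemma opt_cost_attained:
  assumes G: "weighted_graph n E w" and d: "d \<in> carrier_vec n" and "opt_cost n E w d < \<infinity>"
  obtains f where "routes n E f d" "opt_cost n E w d = ereal (flow_cost n E w f)"
proof -
  let ?m = "num_edges n E"
  \<comment> \<open>The infimum of the empty set is \<open>\<infinity>\<close>, so a finite optimum
    provides a flow, which serves as the feasible starting point.\<close>
  obtain f0 where f0: "routes n E f0 d"
    using assms(3) unfolding opt_cost_def INF_less_iff by blast
  obtain f where f: "\<forall>v<n. (\<Sum>l<?m. incidence_mat n E $$ (v, l) * f l) = d $ v"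
    and min: "\<And>g. \<forall>v<n. (\<Sum>l<?m. incidence_mat n E $$ (v, l) * g l) = d $ v \<Longrightarrow>
      (\<Sum>l<?m. edge_weight n E w l * \<bar>f l\<bar>) \<le> (\<Sum>l<?m. edge_weight n E w l * \<bar>g l\<bar>)"
    by (rule linear_system_weighted_l1_minimizer
          [of ?m "edge_weight n E w" n "\<lambda>v l. incidence_mat n E $$ (v, l)" "($) f0" "($) d"])
      (use edge_weight_ge_1[OF G] f0 routes_iff_sum[OF d] in auto)
  have routes: "routes n E (vec ?m f) d"
    using f by (simp add: routes_iff_sum[OF d])
  have "flow_cost n E w (vec ?m f) \<le> flow_cost n E w g" if "routes n E g d" for g
    using that min[of "($) g"] by (simp add: routes_iff_sum[OF d] flow_cost_eq_sum[OF G])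
  then have "opt_cost n E w d = ereal (flow_cost n E w (vec ?m f))"
    unfolding opt_cost_def using routes by (intro antisym INF_lower INF_greatest) auto
  then show thesis
    using that routes by blast
qed

text \<open>Makes the columns admissible test demands for the approximator, which is how its
  inequalities yield bounds edge by edge.\<close>

lemma proper_demand_col_incidence_mat:
  assumes "weighted_graph n E w" and "l < num_edges n E"
  shows "proper_demand n (col (incidence_mat n E) l)"
proof -
  obtain s t where st: "edge_list n E ! l = (s, t)" "s < t" "t < n"
    using edge_list_nth[OF assms] by blast
  \<comment> \<open>The nested conditional splits into a difference of two indicators because
    \<open>s < t\<close> makes the endpoints distinct; each indicator sums to 1 as both endpoints
    are below \<open>n\<close>.\<close>
  have "(\<Sum>v<n. col (incidence_mat n E) l $ v) =
      (\<Sum>v<n. (if v = s then 1 else 0) - (if v = t then 1 else 0))"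
    using assms(2) st by (intro sum.cong) (auto simp: incidence_mat_def)
  also have "\<dots> = 0"
    using st by (simp add: sum_subtractf)
  finally show ?thesis
    by (auto simp: proper_demand_def intro!: carrier_vecI carrier_matD(1)[OF incidence_mat_carrier])
qed

lemma opt_cost_col_incidence_mat_le:
  assumes "weighted_graph n E w" and l: "l < num_edges n E"
  shows "opt_cost n E w (col (incidence_mat n E) l) \<le> ereal (edge_weight n E w l)"
proof -
  let ?u = "unit_vec (num_edges n E) l :: real vec"
  have "routes n E ?u (col (incidence_mat n E) l)"
    using l by (auto simp: routes_def incidence_mat_def)
  moreover have "flow_cost n E w ?u = edge_weight n E w l"
    using l by (simp add: flow_cost_eq_sum[OF assms(1)] sum.remove[of _ l])
  ultimately show ?thesis
    unfolding opt_cost_def by (metis INF_lower mem_Collect_eq)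
qed

lemma sign_vec_scalar_prod_self: "sign_vec x \<bullet> x = l1_norm x"
  by (simp add: sign_vec_def scalar_prod_def l1_norm_def lessThan_atLeast0 mult.commute abs_sgn)

text \<open>Hoelder's inequality for a vector with entries in {-1, 0, 1}. The signs may come from an
  unrelated \<open>y\<close>, as they do when those of \<open>P d\<close> are tested against the
  image of an edge column.\<close>

lemma abs_sign_vec_scalar_prod_le: "\<bar>sign_vec y \<bullet> x\<bar> \<le> l1_norm x" if "dim_vec y = dim_vec x"
proof -
  have "\<bar>sign_vec y \<bullet> x\<bar> \<le> (\<Sum>i<dim_vec x. \<bar>sign_vec y $ i * x $ i\<bar>)"
    by (simp add: scalar_prod_def lessThan_atLeast0)
  also have "\<dots> \<le> l1_norm x"
    unfolding l1_norm_def using that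
    by (intro sum_mono) (auto simp: sign_vec_def abs_mult sgn_if)
  finally show ?thesis .
qed

lemma linf_norm_le:
  assumes "0 \<le> a" and "\<And>i. i < dim_vec x \<Longrightarrow> \<bar>x $ i\<bar> \<le> a"
  shows "linf_norm x \<le> a"
  using assms by (auto simp: linf_norm_def)

theorem theorem4p3:
  assumes "weighted_graph n E w"
    and "0 \<le> \<alpha>"
    and "linear_cost_approximator \<alpha> n E w k P"
  shows "dual_only_preconditioner \<alpha> n E w (\<lambda>d. transpose_mat P *\<^sub>v sign_vec (P *\<^sub>v d))"
  unfolding dual_only_preconditioner_def
proof (intro allI impI)
  fix d assume proper: "proper_demand n d"
  let ?B = "incidence_mat n E" and ?m = "num_edges n E" and ?c = "edge_weight n E w"
  define \<sigma> where "\<sigma> = sign_vec (P *\<^sub>v d)"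
  define \<phi> where "\<phi> = transpose_mat P *\<^sub>v \<sigma>"
  have P: "P \<in> carrier_mat k n"
    and lower: "opt_cost n E w b \<le> ereal (l1_norm (P *\<^sub>v b))"
    and upper: "ereal (l1_norm (P *\<^sub>v b)) \<le> ereal \<alpha> * opt_cost n E w b"
    if "proper_demand n b" for b
    using assms(3) that unfolding linear_cost_approximator_def by auto
  note P = P[OF proper]
  have d: "d \<in> carrier_vec n"
    using proper by (simp add: proper_demand_def)
  have \<sigma>: "\<sigma> \<in> carrier_vec k"
    using carrier_matD(1)[OF P] by (intro carrier_vecI) (simp add: \<sigma>_def sign_vec_def)
  have \<phi>: "\<phi> \<in> carrier_vec n"
    using carrier_matD(2)[OF P] by (intro carrier_vecI) (simp add: \<phi>_def)
  have adjoint: "\<phi> \<bullet> b = \<sigma> \<bullet> (P *\<^sub>v b)" if "b \<in> carrier_vec n" for b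
    unfolding \<phi>_def using transpose_vec_mult_scalar[OF P that \<sigma>] .
  have entry: "\<bar>1 / ?c l * (col ?B l \<bullet> \<phi>)\<bar> \<le> \<alpha>" if l: "l < ?m" for l
  proof -
    have b: "col ?B l \<in> carrier_vec n"
      by (intro carrier_vecI) (simp add: incidence_mat_def)
    have "\<bar>col ?B l \<bullet> \<phi>\<bar> = \<bar>\<sigma> \<bullet> (P *\<^sub>v col ?B l)\<bar>"
      using adjoint[OF b] comm_scalar_prod[OF b \<phi>] by simp
    also have "\<dots> \<le> l1_norm (P *\<^sub>v col ?B l)"
      unfolding \<sigma>_def by (rule abs_sign_vec_scalar_prod_le) simp
    finally have "ereal \<bar>col ?B l \<bullet> \<phi>\<bar> \<le> ereal \<alpha> * opt_cost n E w (col ?B l)"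
      using upper[OF proper_demand_col_incidence_mat[OF assms(1) l]] order_trans ereal_less_eq(3)
      by blast
    \<comment> \<open>Nonnegativity of \<alpha> preserves the inequality; both sides of the chain
      are now finite, so it can be read in the reals.\<close>
    also have "\<dots> \<le> ereal \<alpha> * ereal (?c l)"
      using opt_cost_col_incidence_mat_le[OF assms(1) l] assms(2)
      by (intro ereal_mult_left_mono) auto
    finally have "\<bar>col ?B l \<bullet> \<phi>\<bar> \<le> \<alpha> * ?c l"
      by simp
    then show ?thesis
      using edge_weight_ge_1[OF assms(1) l] by (simp add: abs_mult divide_le_eq)
  qed
  \<comment> \<open>Entry \<open>l\<close> of this vector is exactly the expression bounded in
    \<open>entry\<close>; \<open>0 \<le> \<alpha>\<close> takes care of the 0 inserted in
    \<open>linf_norm\<close>, which is all there is when the graph has no edges.\<close>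
  have "linf_norm (weight_mat_inv n E w *\<^sub>v (transpose_mat ?B *\<^sub>v \<phi>)) \<le> \<alpha>"
    unfolding weight_mat_inv_def
    by (subst mat_diag_mult_vec[of _ ?m], rule carrier_vecI, simp add: incidence_mat_def,
        rule linf_norm_le[OF assms(2)])
      (use entry in \<open>simp add: carrier_matD[OF incidence_mat_carrier]\<close>)
  moreover obtain f where "routes n E f d" "flow_cost n E w f \<le> l1_norm (P *\<^sub>v d)"
  proof -
    \<comment> \<open>Connectedness is not assumed; routability of \<open>d\<close> follows from the
      real upper bound that the approximator puts on its optimal cost.\<close>
    have "opt_cost n E w d < \<infinity>"
      using lower[OF proper] by (auto simp: less_le_trans)
    then show thesis
      using opt_cost_attained[OF assms(1) d] lower[OF proper] that by (metis ereal_less_eq(3))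
  qed
  moreover have "d \<bullet> \<phi> = l1_norm (P *\<^sub>v d)"
    using adjoint[OF d] comm_scalar_prod[OF d \<phi>] by (simp add: \<sigma>_def sign_vec_scalar_prod_self)
  ultimately show "transpose_mat P *\<^sub>v sign_vec (P *\<^sub>v d) \<in> carrier_vec n \<and>
      linf_norm (weight_mat_inv n E w *\<^sub>v
        (transpose_mat ?B *\<^sub>v (transpose_mat P *\<^sub>v sign_vec (P *\<^sub>v d)))) \<le> \<alpha> \<and>
      (\<exists>f. routes n E f d \<and> flow_cost n E w f \<le> d \<bullet> (transpose_mat P *\<^sub>v sign_vec (P *\<^sub>v d)))"
    using \<phi> unfolding \<phi>_def \<sigma>_def by auto
qed

end
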